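(* Let $w\in W\setminus\{e\}$, let $(i_1,\dots,i_d)$ be any word with $\delta(i_1,\dots,i_d)=w$, and let $p\in U(w)$. For $K>0$ let $\Delta^{d-1}_K=\{(t_1,\dots,t_d)\in\mathbb{R}^d_{\ge0} : \sum_{i=1}^d t_i=K\}$. Then $$f_{(i_1,\dots,i_d)}^{-1}(p)\cap\mathbb{R}^d_{\ge0}=f_{(i_1,\dots,i_d)}^{-1}(p)\cap\Delta^{d-1}_K$$ for some real number $K>0$.
   Context: Setting: $G$ is a reductive, connected algebraic group defined and split over $\mathbb{R}$ with a fixed pinning, $U$ is the (real points of the) unipotent radical of the associated Borel subgroup, and $W$ is the Weyl group, assumed finite, with identity $e$, simple reflections $s_1,\dots,s_n$ and length function $\ell$. For each $i$, $x_i:\mathbb{R}\to U$ is the one-parameter homomorphism of the pinning onto the simple root subgroup indexed by $i$ (in type A, $x_i(t)=I_n+tE_{i,i+1}$). A word is a finite sequence with entries in $\{1,\dots,n\}$. Define $f_{(i_1,\dots,i_d)}(t_1,\dots,t_d)=x_{i_1}(t_1)\cdots x_{i_d}(t_d)$. For $w\in W$ with reduced word $R$ of length $r$, $U(w)=f_R(\mathbb{R}^r_{>0})$ (independent of $R$). The Demazure product is the unique associative map $\delta:W\times W\to W$ with $\delta(w,s_i)=ws_i$ if $\ell(ws_i)>\ell(w)$ and $\delta(w,s_i)=w$ otherwise; for a word, $\delta(i_1,\dots,i_d)=\delta(s_{i_1},\dots,s_{i_d})$. *)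

theory Defs
  imports "HOL-Analysis.Analysis" "HOL-Computational_Algebra.Polynomial"
    "HOL-Algebra.Group_Action" "HOL-Algebra.Solvable_Groups"
begin

text \<open>
  Linear algebraic groups are encoded through their complex points, as Zariski-closed
  subgroups of some \<open>GL\<^sub>m(\<complex>)\<close>; an \<open>\<real>\<close>-structure is expressed by real coefficients.
  Every affine algebraic group over \<open>\<real>\<close> has such a closed embedding over \<open>\<real>\<close>.
\<close>

section \<open>Zariski-closed matrix groups\<close>

definition GL :: "(complex^'m^'m) monoid" where
  "GL = \<lparr>carrier = {A. invertible A}, mult = (**), one = mat 1\<rparr>"

abbreviation matgrp :: "(complex^'m^'m) set \<Rightarrow> (complex^'m^'m) monoid" where
  "matgrp H \<equiv> GL\<lparr>carrier := H\<rparr>"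

text \<open>Polynomial functions in the matrix entries, with coefficients in the subfield \<open>K\<close>
  (in use: \<open>\<real>\<close> or \<open>UNIV\<close>).\<close>

inductive_set polyfun :: "complex set \<Rightarrow> (complex^'m^'m \<Rightarrow> complex) set"
  for K :: "complex set" where
  const: "c \<in> K \<Longrightarrow> (\<lambda>A. c) \<in> polyfun K"
| entry: "(\<lambda>A. A $ i $ j) \<in> polyfun K"
| add: "f \<in> polyfun K \<Longrightarrow> g \<in> polyfun K \<Longrightarrow> (\<lambda>A. f A + g A) \<in> polyfun K"
| mult: "f \<in> polyfun K \<Longrightarrow> g \<in> polyfun K \<Longrightarrow> (\<lambda>A. f A * g A) \<in> polyfun K"

definition vanishing_ideal ::
    "complex set \<Rightarrow> (complex^'m^'m) set \<Rightarrow> (complex^'m^'m \<Rightarrow> complex) set" where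
  "vanishing_ideal K H = {f \<in> polyfun K. \<forall>A\<in>H. f A = 0}"

definition zariski :: "(complex^'m^'m) topology" where
  "zariski = topology_generated_by ((\<lambda>f. {A. f A \<noteq> 0}) ` polyfun UNIV)"

definition algebraic_group :: "(complex^'m^'m) set \<Rightarrow> bool" where
  "algebraic_group H \<longleftrightarrow>
     subgroup H GL \<and> closedin (subtopology zariski (carrier GL)) H"

text \<open>The vanishing ideal is spanned over \<open>\<complex> = \<real> \<oplus> \<i>\<real>\<close> by its real members.\<close>

definition defined_over_reals :: "(complex^'m^'m) set \<Rightarrow> bool" where
  "defined_over_reals H \<longleftrightarrow>
     (\<forall>f\<in>vanishing_ideal UNIV H.
        \<exists>g\<in>vanishing_ideal \<real> H. \<exists>h\<in>vanishing_ideal \<real> H. f = (\<lambda>A. g A + \<i> * h A))"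

text \<open>Members of the coordinate ring \<open>K[H]\<close>, where \<open>K[GL\<^sub>m] = K[entries, 1/det]\<close>.\<close>

definition regular_on ::
    "complex set \<Rightarrow> (complex^'m^'m) set \<Rightarrow> (complex^'m^'m \<Rightarrow> complex) \<Rightarrow> bool" where
  "regular_on K H f \<longleftrightarrow> (\<exists>q\<in>polyfun K. \<exists>k::nat. \<forall>A\<in>H. f A = q A / det A ^ k)"

definition alg_hom :: "complex set \<Rightarrow> (complex^'a^'a) set \<Rightarrow> (complex^'b^'b) set \<Rightarrow>
    (complex^'a^'a \<Rightarrow> complex^'b^'b) \<Rightarrow> bool" where
  "alg_hom K H G \<phi> \<longleftrightarrow>
     \<phi> \<in> hom (matgrp H) (matgrp G) \<and> (\<forall>i j. regular_on K H (\<lambda>A. \<phi> A $ i $ j))"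

definition alg_isomorphic ::
    "complex set \<Rightarrow> (complex^'a^'a) set \<Rightarrow> (complex^'b^'b) set \<Rightarrow> bool" where
  "alg_isomorphic K H G \<longleftrightarrow>
     (\<exists>\<phi> \<psi>. alg_hom K H G \<phi> \<and> alg_hom K G H \<psi> \<and>
        (\<forall>A\<in>H. \<psi> (\<phi> A) = A) \<and> (\<forall>A\<in>G. \<phi> (\<psi> A) = A))"

section \<open>Reductive groups, tori and Borel subgroups\<close>

definition unipotent :: "complex^'m^'m \<Rightarrow> bool" where
  "unipotent A \<longleftrightarrow> (\<exists>k. (((**) (A - mat 1)) ^^ k) (mat 1) = 0)"

text \<open>The closed connected normal unipotent subgroups have a largest member, which is
  therefore their union.\<close>

definition unipotent_radical :: "(complex^'m^'m) set \<Rightarrow> (complex^'m^'m) set" where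
  "unipotent_radical G =
     \<Union>{H. algebraic_group H \<and> connectedin zariski H \<and> H \<lhd> matgrp G \<and> (\<forall>A\<in>H. unipotent A)}"

definition connected_reductive :: "(complex^'m^'m) set \<Rightarrow> bool" where
  "connected_reductive G \<longleftrightarrow>
     algebraic_group G \<and> connectedin zariski G \<and> unipotent_radical G = {mat 1}"

text \<open>A copy of \<open>(\<complex>\<^sup>*)\<^sup>I\<close>. Since a torus in \<open>GL\<^sub>m\<close> has rank at most \<open>m\<close>, subsets \<open>I\<close> of the
  index type of the matrices give all ranks that can occur.\<close>

definition diag_torus :: "'m set \<Rightarrow> (complex^'m^'m) set" where
  "diag_torus I =
     {A. (\<forall>i\<in>I. A $ i $ i \<noteq> 0) \<and> (\<forall>i. i \<notin> I \<longrightarrow> A $ i $ i = 1) \<and>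
         (\<forall>i j. i \<noteq> j \<longrightarrow> A $ i $ j = 0)}"

definition torus :: "(complex^'m^'m) set \<Rightarrow> bool" where
  "torus T \<longleftrightarrow>
     algebraic_group T \<and> (\<exists>I :: 'm set. alg_isomorphic UNIV (diag_torus I) T)"

definition split_torus :: "(complex^'m^'m) set \<Rightarrow> bool" where
  "split_torus T \<longleftrightarrow>
     algebraic_group T \<and> defined_over_reals T \<and>
     (\<exists>I :: 'm set. alg_isomorphic \<real> (diag_torus I) T)"

definition maximal_torus :: "(complex^'m^'m) set \<Rightarrow> (complex^'m^'m) set \<Rightarrow> bool" where
  "maximal_torus G T \<longleftrightarrow>
     torus T \<and> T \<subseteq> G \<and> (\<forall>T'. torus T' \<and> T \<subseteq> T' \<and> T' \<subseteq> G \<longrightarrow> T' = T)"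

definition split_over_reals :: "(complex^'m^'m) set \<Rightarrow> bool" where
  "split_over_reals G \<longleftrightarrow> (\<exists>T. maximal_torus G T \<and> split_torus T)"

definition closed_connected_solvable :: "(complex^'m^'m) set \<Rightarrow> bool" where
  "closed_connected_solvable B \<longleftrightarrow>
     algebraic_group B \<and> connectedin zariski B \<and> solvable (matgrp B)"

definition borel_subgroup :: "(complex^'m^'m) set \<Rightarrow> (complex^'m^'m) set \<Rightarrow> bool" where
  "borel_subgroup G B \<longleftrightarrow>
     closed_connected_solvable B \<and> B \<subseteq> G \<and>
     (\<forall>B'. closed_connected_solvable B' \<and> B \<subseteq> B' \<and> B' \<subseteq> G \<longrightarrow> B' = B)"

section \<open>Roots\<close>

text \<open>The tangent space at the identity, as a space of matrices.\<close>

definition lie_algebra :: "(complex^'m^'m) set \<Rightarrow> (complex^'m^'m) set" where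
  "lie_algebra H =
     {X. \<forall>f\<in>vanishing_ideal UNIV H.
           ((\<lambda>z. f (mat 1 + mat z ** X)) has_field_derivative 0) (at 0)}"

definition characters ::
    "(complex^'m^'m) set \<Rightarrow> (complex^'m^'m \<Rightarrow> complex) set" where
  "characters T =
     {\<psi> \<in> extensional T. regular_on UNIV T \<psi> \<and>
        (\<forall>t\<in>T. \<psi> t \<noteq> 0) \<and> (\<forall>s\<in>T. \<forall>t\<in>T. \<psi> (s ** t) = \<psi> s * \<psi> t)}"

definition roots ::
    "(complex^'m^'m) set \<Rightarrow> (complex^'m^'m) set \<Rightarrow> (complex^'m^'m \<Rightarrow> complex) set" where
  "roots T H =
     {\<alpha> \<in> characters T. (\<exists>t\<in>T. \<alpha> t \<noteq> 1) \<and>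
        (\<exists>X\<in>lie_algebra H. X \<noteq> 0 \<and> (\<forall>t\<in>T. t ** X ** matrix_inv t = mat (\<alpha> t) ** X))}"

text \<open>\<open>\<alpha> 1, \<dots>, \<alpha> n\<close> is the base of the root system of \<open>(G, T)\<close> for the positive system of
  the Borel subgroup \<open>B\<close>. The character group is written multiplicatively.\<close>

definition simple_roots :: "(complex^'m^'m) set \<Rightarrow> (complex^'m^'m) set \<Rightarrow>
    (complex^'m^'m) set \<Rightarrow> nat \<Rightarrow> (nat \<Rightarrow> complex^'m^'m \<Rightarrow> complex) \<Rightarrow> bool" where
  "simple_roots G T B n \<alpha> \<longleftrightarrow>
     (\<forall>i\<in>{1..n}. \<alpha> i \<in> roots T B) \<and>
     (\<forall>c :: nat \<Rightarrow> int. (\<forall>t\<in>T. (\<Prod>i=1..n. \<alpha> i t powi c i) = 1) \<longrightarrow> (\<forall>i\<in>{1..n}. c i = 0)) \<and>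
     (\<forall>\<beta>\<in>roots T G. \<exists>c :: nat \<Rightarrow> nat.
        (\<forall>t\<in>T. \<beta> t = (\<Prod>i=1..n. \<alpha> i t ^ c i)) \<or>
        (\<forall>t\<in>T. \<beta> t = inverse (\<Prod>i=1..n. \<alpha> i t ^ c i)))"

text \<open>\<open>x\<close> is an isomorphism, over \<open>\<real>\<close>, of the additive group onto a closed subgroup of \<open>H\<close>
  on which \<open>T\<close> acts through \<open>\<alpha>\<close>.\<close>

definition root_subgroup_param :: "(complex^'m^'m) set \<Rightarrow> (complex^'m^'m) set \<Rightarrow>
    (complex^'m^'m \<Rightarrow> complex) \<Rightarrow> (complex \<Rightarrow> complex^'m^'m) \<Rightarrow> bool" where
  "root_subgroup_param T H \<alpha> x \<longleftrightarrow>
     range x \<subseteq> H \<and> algebraic_group (range x) \<and>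
     (\<forall>a b. x (a + b) = x a ** x b) \<and>
     (\<forall>i j. \<exists>q :: real poly. \<forall>a. x a $ i $ j = poly (map_poly of_real q) a) \<and>
     (\<exists>g. regular_on \<real> (range x) g \<and> (\<forall>a. g (x a) = a)) \<and>
     (\<forall>t\<in>T. \<forall>a. t ** x a ** matrix_inv t = x (\<alpha> t * a))"

section \<open>Pinnings\<close>

record 'm pinning =
  srank :: nat
  maxtorus :: "(complex^'m::finite^'m) set"
  borel_pos :: "(complex^'m^'m) set"
  borel_neg :: "(complex^'m^'m) set"
  sroot :: "nat \<Rightarrow> complex^'m^'m \<Rightarrow> complex"
  xsub :: "nat \<Rightarrow> complex \<Rightarrow> complex^'m^'m"
  ysub :: "nat \<Rightarrow> complex \<Rightarrow> complex^'m^'m"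

definition SL2 :: "(complex^2^2) set" where
  "SL2 = {A. det A = 1}"

definition is_pinning :: "(complex^'m^'m) set \<Rightarrow> 'm::finite pinning \<Rightarrow> bool" where
  "is_pinning G P \<longleftrightarrow>
     maximal_torus G (maxtorus P) \<and> split_torus (maxtorus P) \<and>
     borel_subgroup G (borel_pos P) \<and> defined_over_reals (borel_pos P) \<and>
     borel_subgroup G (borel_neg P) \<and> defined_over_reals (borel_neg P) \<and>
     borel_pos P \<inter> borel_neg P = maxtorus P \<and>
     simple_roots G (maxtorus P) (borel_pos P) (srank P) (sroot P) \<and>
     (\<forall>i\<in>{1..srank P}.
        root_subgroup_param (maxtorus P) (unipotent_radical (borel_pos P))
          (sroot P i) (xsub P i) \<and>
        root_subgroup_param (maxtorus P) (unipotent_radical (borel_neg P))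
          (\<lambda>t. inverse (sroot P i t)) (ysub P i) \<and>
        (\<exists>\<phi>. alg_hom \<real> SL2 G \<phi> \<and>
           (\<forall>a. \<phi> (vector [vector [1, a], vector [0, 1]]) = xsub P i a) \<and>
           (\<forall>a. \<phi> (vector [vector [1, 0], vector [a, 1]]) = ysub P i a) \<and>
           (\<forall>b. b \<noteq> 0 \<longrightarrow> \<phi> (vector [vector [b, 0], vector [0, inverse b]]) \<in> maxtorus P)))"

section \<open>The Weyl group and the Demazure product\<close>

definition weyl :: "(complex^'m^'m) set \<Rightarrow> 'm::finite pinning \<Rightarrow> (complex^'m^'m) set monoid" where
  "weyl G P = matgrp (normalizer (matgrp G) (maxtorus P)) Mod maxtorus P"

text \<open>The representative \<open>x\<^sub>i(1) y\<^sub>i(-1) x\<^sub>i(1)\<close> is the image of the \<open>SL\<^sub>2\<close> matrix with rows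
  \<open>(0, 1)\<close> and \<open>(-1, 0)\<close>.\<close>

definition simple_reflection :: "'m::finite pinning \<Rightarrow> nat \<Rightarrow> (complex^'m^'m) set" where
  "simple_reflection P i =
     maxtorus P #>\<^bsub>GL\<^esub> (xsub P i 1 ** ysub P i (- 1) ** xsub P i 1)"

definition is_word :: "'m::finite pinning \<Rightarrow> nat list \<Rightarrow> bool" where
  "is_word P v \<longleftrightarrow> set v \<subseteq> {1..srank P}"

definition word_prod ::
    "(complex^'m^'m) set \<Rightarrow> 'm::finite pinning \<Rightarrow> nat list \<Rightarrow> (complex^'m^'m) set" where
  "word_prod G P v =
     foldr (\<lambda>i u. simple_reflection P i \<otimes>\<^bsub>weyl G P\<^esub> u) v \<one>\<^bsub>weyl G P\<^esub>"

definition weyl_length ::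
    "(complex^'m^'m) set \<Rightarrow> 'm::finite pinning \<Rightarrow> (complex^'m^'m) set \<Rightarrow> nat" where
  "weyl_length G P w = (LEAST k. \<exists>v. is_word P v \<and> length v = k \<and> word_prod G P v = w)"

definition reduced_word ::
    "(complex^'m^'m) set \<Rightarrow> 'm::finite pinning \<Rightarrow> (complex^'m^'m) set \<Rightarrow> nat list \<Rightarrow> bool" where
  "reduced_word G P w R \<longleftrightarrow>
     is_word P R \<and> word_prod G P R = w \<and> length R = weyl_length G P w"

text \<open>These conditions determine \<open>\<delta> u v\<close> whenever \<open>v\<close> is not the identity, hence the value
  of \<open>\<delta>\<close> on every nonempty word.\<close>

definition is_demazure_product :: "(complex^'m^'m) set \<Rightarrow> 'm::finite pinning \<Rightarrow>
    ((complex^'m^'m) set \<Rightarrow> (complex^'m^'m) set \<Rightarrow> (complex^'m^'m) set) \<Rightarrow> bool" where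
  "is_demazure_product G P \<delta> \<longleftrightarrow>
     (let W = weyl G P; s = simple_reflection P; l = weyl_length G P in
       \<delta> \<in> carrier W \<rightarrow> carrier W \<rightarrow> carrier W \<and>
       (\<forall>u\<in>carrier W. \<forall>v\<in>carrier W. \<forall>w\<in>carrier W. \<delta> (\<delta> u v) w = \<delta> u (\<delta> v w)) \<and>
       (\<forall>w\<in>carrier W. \<forall>i\<in>{1..srank P}.
          \<delta> w (s i) = (if l (w \<otimes>\<^bsub>W\<^esub> s i) > l w then w \<otimes>\<^bsub>W\<^esub> s i else w)))"

definition demazure_word :: "(complex^'m^'m) set \<Rightarrow> 'm::finite pinning \<Rightarrow>
    ((complex^'m^'m) set \<Rightarrow> (complex^'m^'m) set \<Rightarrow> (complex^'m^'m) set) \<Rightarrow>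
    nat list \<Rightarrow> (complex^'m^'m) set" where
  "demazure_word G P \<delta> v =
     (case v of [] \<Rightarrow> \<one>\<^bsub>weyl G P\<^esub>
      | i # u \<Rightarrow> foldl \<delta> (simple_reflection P i) (map (simple_reflection P) u))"

section \<open>The maps \<open>f\<close> and the cells \<open>U(w)\<close>\<close>

text \<open>\<open>\<real>\<^sup>d\<close> is the set of real lists of length \<open>d\<close>. At real arguments the \<open>x\<^sub>i\<close> take values in
  the real points of the unipotent radical of the positive Borel subgroup.\<close>

definition fword :: "'m::finite pinning \<Rightarrow> nat list \<Rightarrow> real list \<Rightarrow> complex^'m^'m" where
  "fword P v ts = foldr (\<lambda>(i, t) A. xsub P i (of_real t) ** A) (zip v ts) (mat 1)"

definition pos_orthant :: "nat \<Rightarrow> real list set" where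
  "pos_orthant d = {ts. length ts = d \<and> (\<forall>t\<in>set ts. t > 0)}"

definition nonneg_orthant :: "nat \<Rightarrow> real list set" where
  "nonneg_orthant d = {ts. length ts = d \<and> (\<forall>t\<in>set ts. t \<ge> 0)}"

definition std_simplex :: "nat \<Rightarrow> real \<Rightarrow> real list set" where
  "std_simplex d K = {ts \<in> nonneg_orthant d. sum_list ts = K}"

text \<open>All reduced words of \<open>w\<close> give the same image, so the union equals each of its members.\<close>

definition Ucell ::
    "(complex^'m^'m) set \<Rightarrow> 'm::finite pinning \<Rightarrow> (complex^'m^'m) set \<Rightarrow> (complex^'m^'m) set" where
  "Ucell G P w = (\<Union>R\<in>{R. reduced_word G P w R}. fword P R ` pos_orthant (length R))"

end

theory Submission
  imports Defs
begin

text \<open>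
  The sum of the parameters \<open>t\<^sub>1, \<dots>, t\<^sub>d\<close> can be read off from the product
  \<open>p = x\<^bsub>i\<^sub>1\<^esub>(t\<^sub>1) \<cdots> x\<^bsub>i\<^sub>d\<^esub>(t\<^sub>d)\<close>, whatever the word. The conceptual reason is that the
  abelianization of \<open>U\<close> surjects onto the product of the simple root subgroups, so that there is
  a homomorphism \<open>U \<rightarrow> \<real>\<close> sending each \<open>x\<^sub>i(t)\<close> to \<open>t\<close>; in type A it adds the superdiagonal
  entries. Hence \<open>K\<close> is the sum of the parameters in a factorization of \<open>p\<close> along a reduced word
  of \<open>w\<close>. These parameters are positive, and there is at least one of them because \<open>w \<noteq> e\<close>.

  Instead of the structure theory of \<open>U\<close>, the argument uses the weights of the torus on matrices.
  Conjugation by \<open>\<tau> \<in> T\<close> replaces \<open>t\<^sub>j\<close> by \<open>\<alpha>\<^bsub>i\<^sub>j\<^esub>(\<tau>) t\<^sub>j\<close>. Now let \<open>z\<^sub>i\<close> stand for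
  \<open>\<alpha>\<^sub>i(\<tau>)\<close> and expand
  the product as a matrix-valued polynomial in the \<open>z\<^sub>i\<close>: it is \<open>1 + \<Sum>\<^sub>i z\<^sub>i s\<^sub>i X\<^sub>i\<close> plus terms of
  degree at least 2, where \<open>X\<^sub>i = x\<^sub>i'(0)\<close> and \<open>s\<^sub>i\<close> is the sum of the \<open>t\<^sub>j\<close> with \<open>i\<^sub>j = i\<close>
  (\<open>first_order_scaled\<close>). The simple roots are multiplicatively independent, so different
  monomials in them are different characters of \<open>T\<close>, which are linearly independent. Therefore
  \<open>p\<close> determines the linear part of this polynomial (\<open>linear_part_zero\<close>), and as \<open>X\<^sub>i \<noteq> 0\<close>
  (\<open>velocity_nonzero\<close>) it determines every \<open>s\<^sub>i\<close> (\<open>letter_sum_unique\<close>) and their sum.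
\<close>

section \<open>Linear independence of characters\<close>

text \<open>
  Dedekind's argument: comparing a relation translated by \<open>s\<close> with \<open>\<psi>\<^sub>k(s)\<close> times the relation
  eliminates \<open>\<psi>\<^sub>k\<close>, and keeps the term of a given \<open>\<psi>\<^sub>i\<close> if \<open>s\<close> separates the two.
\<close>

lemma characters_linearly_independent:
  fixes \<psi> :: "'i \<Rightarrow> 'g \<Rightarrow> 'k::field"
  assumes "finite I"
    and closed: "\<And>s t. s \<in> T \<Longrightarrow> t \<in> T \<Longrightarrow> mul s t \<in> T"
    and "T \<noteq> {}"
    and mult: "\<And>i s t. i \<in> I \<Longrightarrow> s \<in> T \<Longrightarrow> t \<in> T \<Longrightarrow> \<psi> i (mul s t) = \<psi> i s * \<psi> i t"
    and nz: "\<And>i t. i \<in> I \<Longrightarrow> t \<in> T \<Longrightarrow> \<psi> i t \<noteq> 0"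
    and distinct: "\<And>i j. i \<in> I \<Longrightarrow> j \<in> I \<Longrightarrow> i \<noteq> j \<Longrightarrow> \<exists>t\<in>T. \<psi> i t \<noteq> \<psi> j t"
    and rel: "\<And>t. t \<in> T \<Longrightarrow> (\<Sum>i\<in>I. a i * \<psi> i t) = 0"
  shows "\<forall>i\<in>I. a i = 0"
  using \<open>finite I\<close> mult nz distinct rel
proof (induction I arbitrary: a rule: finite_induct)
  case empty
  then show ?case by simp
next
  case (insert k I)
  have zero: "a i = 0" if "i \<in> I" for i
  proof -
    obtain s where s: "s \<in> T" "\<psi> k s \<noteq> \<psi> i s"
      using insert.prems(3)[of k i] insert.hyps \<open>i \<in> I\<close> by auto
    have rel': "(\<Sum>j\<in>I. (a j * (\<psi> j s - \<psi> k s)) * \<psi> j t) = 0" if "t \<in> T" for t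
    proof -
      have "(\<Sum>j\<in>insert k I. a j * \<psi> j (mul s t)) - \<psi> k s * (\<Sum>j\<in>insert k I. a j * \<psi> j t) = 0"
        using insert.prems(4) closed s(1) that by simp
      moreover have "(\<Sum>j\<in>insert k I. a j * \<psi> j (mul s t)) = (\<Sum>j\<in>insert k I. a j * (\<psi> j s * \<psi> j t))"
        by (intro sum.cong) (auto simp: insert.prems(1) s(1) that)
      moreover have "(\<Sum>j\<in>insert k I. a j * (\<psi> j s * \<psi> j t)) - \<psi> k s * (\<Sum>j\<in>insert k I. a j * \<psi> j t)
          = (\<Sum>j\<in>insert k I. (a j * (\<psi> j s - \<psi> k s)) * \<psi> j t)"
        unfolding sum_distrib_left sum_subtractf[symmetric]
        by (intro sum.cong) (auto simp: algebra_simps)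
      ultimately show ?thesis using insert.hyps by simp
    qed
    have "\<forall>j\<in>I. a j * (\<psi> j s - \<psi> k s) = 0"
      by (rule insert.IH) (use insert.prems rel' in auto)
    then show ?thesis using \<open>i \<in> I\<close> s(2) by auto
  qed
  obtain t where "t \<in> T" using \<open>T \<noteq> {}\<close> by auto
  then have "a k = 0"
    using insert.prems(4)[of t] insert.prems(2)[of k t] insert.hyps zero by simp
  with zero show ?case by auto
qed

section \<open>Polynomial functions without terms of low degree\<close>

text \<open>
  These are the polynomial functions in the variables \<open>z\<^sub>i\<close>, \<open>i \<in> I\<close>, all of whose monomials have
  degree at least \<open>k\<close>. Exponents vanish outside \<open>I\<close> so that different exponent functions
  are different monomials.
\<close>

inductive_set order_ge :: "'i set \<Rightarrow> nat \<Rightarrow> (('i \<Rightarrow> complex) \<Rightarrow> complex) set"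
  for I :: "'i set" and k :: nat where
  zero: "(\<lambda>z. 0) \<in> order_ge I k"
| step: "f \<in> order_ge I k \<Longrightarrow> k \<le> sum c I \<Longrightarrow> (\<And>i. i \<notin> I \<Longrightarrow> c i = 0) \<Longrightarrow>
    (\<lambda>z. f z + a * (\<Prod>i\<in>I. z i ^ c i)) \<in> order_ge I k"

lemma order_ge_mono: "f \<in> order_ge I k \<Longrightarrow> j \<le> k \<Longrightarrow> f \<in> order_ge I j"
  by (induction rule: order_ge.induct) (auto intro: order_ge.intros)

lemma order_ge_add:
  assumes "f \<in> order_ge I k" "g \<in> order_ge I k"
  shows "(\<lambda>z. f z + g z) \<in> order_ge I k"
  using assms(2)
proof (induction rule: order_ge.induct)
  case zero
  then show ?case using assms(1) by simp
next
  case (step g c a)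
  from order_ge.step[OF step.IH step.hyps(2,3), of a] show ?case by (simp add: add.assoc)
qed

lemma order_ge_mult_monomial:
  assumes "f \<in> order_ge I j" "k \<le> sum c I" "\<And>i. i \<notin> I \<Longrightarrow> c i = 0"
  shows "(\<lambda>z. f z * (a * (\<Prod>i\<in>I. z i ^ c i))) \<in> order_ge I (j + k)"
  using assms(1)
proof (induction rule: order_ge.induct)
  case zero
  then show ?case by (simp add: order_ge.zero)
next
  case (step f d b)
  have "(\<lambda>z. f z * (a * (\<Prod>i\<in>I. z i ^ c i)) + (b * a) * (\<Prod>i\<in>I. z i ^ (d i + c i)))
      \<in> order_ge I (j + k)"
    by (rule order_ge.step[OF step.IH]) (use step.hyps assms in \<open>auto simp: sum.distrib\<close>)
  then show ?case by (simp add: power_add prod.distrib algebra_simps)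
qed

lemma order_ge_mult:
  assumes "f \<in> order_ge I j" "g \<in> order_ge I k"
  shows "(\<lambda>z. f z * g z) \<in> order_ge I (j + k)"
  using assms(2)
proof (induction rule: order_ge.induct)
  case zero
  then show ?case by (simp add: order_ge.zero)
next
  case (step g c a)
  from order_ge_add[OF step.IH order_ge_mult_monomial[OF assms(1) step.hyps(2,3), of a]]
  show ?case by (simp add: distrib_left)
qed

lemma order_ge_const: "(\<lambda>z. a) \<in> order_ge I 0"
  using order_ge.step[OF order_ge.zero, of 0 "\<lambda>_. 0" I a] by simp

lemma order_ge_cmult: "f \<in> order_ge I k \<Longrightarrow> (\<lambda>z. a * f z) \<in> order_ge I k"
  using order_ge_mult[OF order_ge_const] by simp

lemma order_ge_var:
  assumes "finite I" "i \<in> I"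
  shows "(\<lambda>z. z i) \<in> order_ge I 1"
proof -
  have "(\<lambda>z. 0 + 1 * (\<Prod>j\<in>I. z j ^ (if j = i then 1 else 0))) \<in> order_ge I 1"
    by (rule order_ge.step[OF order_ge.zero]) (use assms in auto)
  moreover have "(\<Prod>j\<in>I. z j ^ (if j = i then 1 else 0)) = z i" for z :: "_ \<Rightarrow> complex"
    using assms by (simp add: if_distrib cong: if_cong)
  ultimately show ?thesis by simp
qed

lemma order_ge_sum:
  assumes "\<And>s. s \<in> S \<Longrightarrow> f s \<in> order_ge I k"
  shows "(\<lambda>z. \<Sum>s\<in>S. f s z) \<in> order_ge I k"
  using assms by (induction S rule: infinite_finite_induct) (auto intro: order_ge.zero order_ge_add)

lemma order_ge_poly:
  assumes "finite I" "i \<in> I"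
  shows "(\<lambda>z. poly q (z i * t)) \<in> order_ge I 0"
proof (induction q)
  case 0
  then show ?case by (simp add: order_ge.zero)
next
  case (pCons a q)
  have "(\<lambda>z. z i * t) \<in> order_ge I 0"
    using order_ge_cmult[OF order_ge_mono[OF order_ge_var[OF assms], of 0], of t]
    by (simp add: mult.commute)
  from order_ge_add[OF order_ge_const[of a] order_ge_mult[OF this pCons.IH, simplified]]
  show ?case by simp
qed

text \<open>
  Independence of characters needs each monomial only once, whereas the inductive generation may
  add the same monomial repeatedly; here its coefficients are collected.
\<close>

lemma order_ge_normal_form:
  assumes "f \<in> order_ge I k"
  shows "\<exists>S a. finite S \<and> (\<forall>c\<in>S. k \<le> sum c I \<and> (\<forall>i. i \<notin> I \<longrightarrow> c i = 0)) \<and>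
      (\<forall>z. f z = (\<Sum>c\<in>S. a c * (\<Prod>i\<in>I. z i ^ c i)))"
  using assms
proof (induction rule: order_ge.induct)
  case zero
  show ?case by (intro exI[of _ "{}"]) simp
next
  case (step f d b)
  then obtain S a where S: "finite S" "\<forall>c\<in>S. k \<le> sum c I \<and> (\<forall>i. i \<notin> I \<longrightarrow> c i = 0)"
    "\<forall>z. f z = (\<Sum>c\<in>S. a c * (\<Prod>i\<in>I. z i ^ c i))"
    by blast
  define a' where "a' c = (if c \<in> S then a c else 0) + (if c = d then b else 0)" for c
  have "f z + b * (\<Prod>i\<in>I. z i ^ d i) = (\<Sum>c\<in>insert d S. a' c * (\<Prod>i\<in>I. z i ^ c i))" for z
  proof -
    have "(\<Sum>c\<in>insert d S. a' c * (\<Prod>i\<in>I. z i ^ c i))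
        = (\<Sum>c\<in>insert d S. (if c \<in> S then a c else 0) * (\<Prod>i\<in>I. z i ^ c i))
          + (\<Sum>c\<in>insert d S. if c = d then b * (\<Prod>i\<in>I. z i ^ c i) else 0)"
      unfolding a'_def sum.distrib[symmetric] by (intro sum.cong) (auto simp: algebra_simps)
    also have "(\<Sum>c\<in>insert d S. (if c \<in> S then a c else 0) * (\<Prod>i\<in>I. z i ^ c i))
        = (\<Sum>c\<in>S. a c * (\<Prod>i\<in>I. z i ^ c i))"
      by (rule sum.mono_neutral_cong_right) (use S(1) in auto)
    also have "(\<Sum>c\<in>insert d S. if c = d then b * (\<Prod>i\<in>I. z i ^ c i) else 0)
        = b * (\<Prod>i\<in>I. z i ^ d i)"
      using S(1) by (simp add: sum.delta)
    finally show ?thesis using S(3) by simp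
  qed
  moreover have "\<forall>c\<in>insert d S. k \<le> sum c I \<and> (\<forall>i. i \<notin> I \<longrightarrow> c i = 0)"
    using S(2) step.hyps(2,3) by simp
  moreover have "finite (insert d S)" using S(1) by simp
  ultimately show ?case by (intro exI[of _ "insert d S"] exI[of _ a'] conjI allI)
qed

text \<open>
  For multiplicatively independent \<open>\<alpha>\<^sub>i\<close>, a polynomial that vanishes at \<open>z\<^sub>i = \<alpha>\<^sub>i(t)\<close> for all \<open>t\<close>
  is a linear relation between the distinct characters \<open>\<Prod>\<^sub>i \<alpha>\<^sub>i\<^bsup>c i\<^esup>\<close>, so all its
  coefficients are zero.
\<close>

lemma linear_part_zero:
  fixes \<alpha> :: "'i \<Rightarrow> 'g \<Rightarrow> complex"
  assumes "finite I"
    and closed: "\<And>s t. s \<in> T \<Longrightarrow> t \<in> T \<Longrightarrow> mul s t \<in> T"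
    and ne: "T \<noteq> {}"
    and mult: "\<And>i s t. i \<in> I \<Longrightarrow> s \<in> T \<Longrightarrow> t \<in> T \<Longrightarrow> \<alpha> i (mul s t) = \<alpha> i s * \<alpha> i t"
    and nz: "\<And>i t. i \<in> I \<Longrightarrow> t \<in> T \<Longrightarrow> \<alpha> i t \<noteq> 0"
    and indep: "\<And>c :: 'i \<Rightarrow> int. (\<And>t. t \<in> T \<Longrightarrow> (\<Prod>i\<in>I. \<alpha> i t powi c i) = 1) \<Longrightarrow> \<forall>i\<in>I. c i = 0"
    and f: "f \<in> order_ge I 2"
    and rel: "\<And>t. t \<in> T \<Longrightarrow> (\<Sum>i\<in>I. d i * \<alpha> i t) + f (\<lambda>i. \<alpha> i t) = 0"
    and "j \<in> I"
  shows "d j = 0"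
proof -
  obtain S a where S_props: "finite S" "\<forall>c\<in>S. 2 \<le> sum c I \<and> (\<forall>i. i \<notin> I \<longrightarrow> c i = 0)"
      "\<forall>z. f z = (\<Sum>c\<in>S. a c * (\<Prod>i\<in>I. z i ^ c i))"
    using order_ge_normal_form[OF f] by (elim exE conjE)
  then have S: "finite S" "\<And>c. c \<in> S \<Longrightarrow> 2 \<le> sum c I"
      "\<And>c i. c \<in> S \<Longrightarrow> i \<notin> I \<Longrightarrow> c i = 0"
      "\<And>z. f z = (\<Sum>c\<in>S. a c * (\<Prod>i\<in>I. z i ^ c i))"
    by simp_all
  \<comment> \<open>The monomials that occur: \<open>Inl i\<close> is the variable \<open>z\<^sub>i\<close>, \<open>Inr c\<close> a monomial of \<open>f\<close>.
    Their exponents differ, since those of \<open>f\<close> have total degree at least 2.\<close>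
  define ex :: "'i + ('i \<Rightarrow> nat) \<Rightarrow> 'i \<Rightarrow> nat"
    where "ex = case_sum (\<lambda>i j. if j = i then 1 else 0) id"
  define \<psi> where "\<psi> x t = (\<Prod>i\<in>I. \<alpha> i t ^ ex x i)" for x t
  have \<psi>_Inl: "\<psi> (Inl i) t = \<alpha> i t" if "i \<in> I" for i t
    using that \<open>finite I\<close> by (simp add: \<psi>_def ex_def if_distrib cong: if_cong)
  have supp: "ex x i = 0" if "x \<in> I <+> S" "i \<notin> I" for x i
    using that S(3) by (auto simp: ex_def)
  have inj: "inj_on ex (I <+> S)"
  proof (rule inj_onI)
    have deg: "sum (ex (Inl i)) I = 1" if "i \<in> I" for i
      using that \<open>finite I\<close> by (simp add: ex_def)
    have lin: False if "i \<in> I" "c \<in> S" "ex (Inl i) = ex (Inr c)" for i c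
      using deg[OF that(1)] S(2)[OF that(2)] unfolding that(3) by (simp add: ex_def)
    have unit: "i = i'" if "ex (Inl i) = ex (Inl i')" for i i'
      using fun_cong[OF that, of i] by (simp add: ex_def split: if_splits)
    fix x y assume x: "x \<in> I <+> S" and y: "y \<in> I <+> S" and eq: "ex x = ex y"
    show "x = y"
    proof (cases x)
      case (Inl i)
      then show ?thesis using x y eq by (cases y) (auto dest: lin unit)
    next
      case (Inr c)
      show ?thesis
      proof (cases y)
        case (Inl i)
        then show ?thesis using lin[of i c] Inr x y eq by auto
      next
        case (Inr c')
        then show ?thesis using \<open>x = Inr c\<close> eq by (simp add: ex_def)
      qed
    qed
  qed
  have "\<forall>x\<in>I <+> S. case_sum d a x = 0"
  proof (rule characters_linearly_independent[where \<psi> = \<psi> and T = T and mul = mul])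
    show "\<psi> x (mul s t) = \<psi> x s * \<psi> x t" if "s \<in> T" "t \<in> T" for x s t
      using mult that by (simp add: \<psi>_def power_mult_distrib prod.distrib)
    show "\<psi> x t \<noteq> 0" if "t \<in> T" for x t
      using nz that \<open>finite I\<close> by (simp add: \<psi>_def)
    show "\<exists>t\<in>T. \<psi> x t \<noteq> \<psi> y t" if xy: "x \<in> I <+> S" "y \<in> I <+> S" "x \<noteq> y" for x y
    proof (rule ccontr)
      assume "\<not> ?thesis"
      then have eq: "\<psi> x t = \<psi> y t" if "t \<in> T" for t using that by auto
      have "\<forall>i\<in>I. int (ex x i) - int (ex y i) = 0"
      proof (rule indep)
        fix t assume t: "t \<in> T"
        have "(\<Prod>i\<in>I. \<alpha> i t powi (int (ex x i) - int (ex y i))) = \<psi> x t / \<psi> y t"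
          unfolding \<psi>_def prod_dividef[symmetric]
          by (intro prod.cong) (use nz t in \<open>auto simp: power_int_diff\<close>)
        also have "\<dots> = 1"
          using eq[OF t] nz t \<open>finite I\<close> by (simp add: \<psi>_def)
        finally show "(\<Prod>i\<in>I. \<alpha> i t powi (int (ex x i) - int (ex y i))) = 1" .
      qed
      then have "ex x i = ex y i" for i
        using supp xy by (cases "i \<in> I") auto
      then have "ex x = ex y" by auto
      with inj xy show False by (auto dest: inj_onD)
    qed
    show "(\<Sum>x\<in>I <+> S. case_sum d a x * \<psi> x t) = 0" if "t \<in> T" for t
    proof -
      have "(\<Sum>x\<in>I <+> S. case_sum d a x * \<psi> x t)
          = (\<Sum>i\<in>I. d i * \<psi> (Inl i) t) + (\<Sum>c\<in>S. a c * \<psi> (Inr c) t)"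
        using \<open>finite I\<close> S(1) by (simp add: sum.Plus)
      also have "(\<Sum>i\<in>I. d i * \<psi> (Inl i) t) = (\<Sum>i\<in>I. d i * \<alpha> i t)"
        by (intro sum.cong) (auto simp: \<psi>_Inl)
      also have "(\<Sum>c\<in>S. a c * \<psi> (Inr c) t) = f (\<lambda>i. \<alpha> i t)"
        by (simp add: S(4) \<psi>_def ex_def)
      finally show ?thesis using rel[OF that] by simp
    qed
  qed (use closed ne \<open>finite I\<close> S(1) in auto)
  from bspec[OF this InlI[OF \<open>j \<in> I\<close>]] show ?thesis by simp
qed

section \<open>First-order expansions of matrix-valued polynomials\<close>

text \<open>\<open>A(z) = 1 + \<Sum>\<^sub>i z\<^sub>i Y\<^sub>i\<close> up to terms of degree at least 2.\<close>

definition first_order ::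
    "'i set \<Rightarrow> (('i \<Rightarrow> complex) \<Rightarrow> complex^'m^'m) \<Rightarrow> ('i \<Rightarrow> complex^'m^'m) \<Rightarrow> bool" where
  "first_order I A Y \<longleftrightarrow>
     (\<forall>j k. (\<lambda>z. A z $ j $ k - (mat 1 $ j $ k + (\<Sum>i\<in>I. Y i $ j $ k * z i))) \<in> order_ge I 2)"

lemma first_order_one: "first_order I (\<lambda>z. mat 1) (\<lambda>i. 0)"
  by (simp add: first_order_def order_ge.zero)

text \<open>
  Linear parts add under multiplication because both factors have constant part 1; this turns the
  noncommutative product along a word into a sum.
\<close>

lemma first_order_mult:
  fixes A B :: "('i \<Rightarrow> complex) \<Rightarrow> complex^'m::finite^'m"
  assumes "finite I" "first_order I A Y" "first_order I B Z"
  shows "first_order I (\<lambda>z. A z ** B z) (\<lambda>i. Y i + Z i)"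
  unfolding first_order_def
proof (intro allI)
  fix j k :: 'm
  define \<epsilon> :: "'m \<Rightarrow> 'm \<Rightarrow> complex" where "\<epsilon> j k = mat 1 $ j $ k" for j k
  define LA where "LA j k z = (\<Sum>i\<in>I. Y i $ j $ k * z i)" for j k z
  define LB where "LB j k z = (\<Sum>i\<in>I. Z i $ j $ k * z i)" for j k z
  define HA where "HA j k z = A z $ j $ k - (\<epsilon> j k + LA j k z)" for j k z
  define HB where "HB j k z = B z $ j $ k - (\<epsilon> j k + LB j k z)" for j k z
  have HA: "HA j k \<in> order_ge I 2" and HB: "HB j k \<in> order_ge I 2" for j k
    using assms(2,3) unfolding first_order_def HA_def HB_def LA_def LB_def \<epsilon>_def by auto
  have LA: "LA j k \<in> order_ge I 1" and LB: "LB j k \<in> order_ge I 1" for j k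
    unfolding LA_def LB_def
    by (intro order_ge_sum order_ge_cmult order_ge_var \<open>finite I\<close>; assumption)+
  have B0: "(\<lambda>z. B z $ l $ k) \<in> order_ge I 0" for l
  proof -
    have "(\<lambda>z. \<epsilon> l k + (LB l k z + HB l k z)) \<in> order_ge I 0"
      by (intro order_ge_add order_ge_const order_ge_mono[OF LB] order_ge_mono[OF HB]) auto
    then show ?thesis by (simp add: HB_def)
  qed
  have BL: "(\<lambda>z. LB l k z + HB l k z) \<in> order_ge I 1" for l
    by (intro order_ge_add LB order_ge_mono[OF HB]) auto
  \<comment> \<open>The remainder of \<open>(1 + LA + HA) B\<close>, with \<open>B = 1 + LB + HB\<close>, after removing \<open>1 + LA + LB\<close>.\<close>
  have R: "(\<lambda>z. HB j k z + (\<Sum>l\<in>UNIV. LA j l z * (LB l k z + HB l k z) + HA j l z * B z $ l $ k))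
      \<in> order_ge I 2"
    using order_ge_mult[OF LA BL] order_ge_mult[OF HA B0]
    by (intro order_ge_add order_ge_sum HB) (simp_all add: numeral_2_eq_2)
  have \<epsilon>_left: "(\<Sum>l\<in>UNIV. \<epsilon> j l * g l) = g j" for g
    by (simp add: \<epsilon>_def mat_def if_distrib[of "\<lambda>x. x * _"] cong: if_cong)
  have \<epsilon>_right: "(\<Sum>l\<in>UNIV. g l * \<epsilon> l k) = g k" for g
    by (simp add: \<epsilon>_def mat_def if_distrib[of "\<lambda>x. _ * x"] cong: if_cong)
  have "(A z ** B z) $ j $ k - (mat 1 $ j $ k + (\<Sum>i\<in>I. (Y i + Z i) $ j $ k * z i))
      = HB j k z + (\<Sum>l\<in>UNIV. LA j l z * (LB l k z + HB l k z) + HA j l z * B z $ l $ k)" for z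
  proof -
    have "A z $ j $ l * B z $ l $ k = \<epsilon> j l * B z $ l $ k + LA j l z * \<epsilon> l k
        + (LA j l z * (LB l k z + HB l k z) + HA j l z * B z $ l $ k)" for l
      by (simp add: HA_def HB_def algebra_simps)
    then have "(A z ** B z) $ j $ k = B z $ j $ k + LA j k z
        + (\<Sum>l\<in>UNIV. LA j l z * (LB l k z + HB l k z) + HA j l z * B z $ l $ k)"
      by (simp add: matrix_matrix_mult_def sum.distrib \<epsilon>_left \<epsilon>_right)
    moreover have "(\<Sum>i\<in>I. (Y i + Z i) $ j $ k * z i) = LA j k z + LB j k z"
      by (simp add: LA_def LB_def sum.distrib distrib_right)
    ultimately show ?thesis by (simp add: HB_def \<epsilon>_def)
  qed
  with R show "(\<lambda>z. (A z ** B z) $ j $ k - (mat 1 $ j $ k + (\<Sum>i\<in>I. (Y i + Z i) $ j $ k * z i)))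
      \<in> order_ge I 2" by simp
qed

section \<open>One-parameter subgroups\<close>

definition poly_matrix :: "(complex \<Rightarrow> complex^'m^'m) \<Rightarrow> bool" where
  "poly_matrix x \<longleftrightarrow> (\<forall>j k. \<exists>q. \<forall>a. x a $ j $ k = poly q a)"

definition velocity :: "(complex \<Rightarrow> complex^'m^'m) \<Rightarrow> complex^'m^'m" where
  "velocity x = (\<chi> j k. deriv (\<lambda>a. x a $ j $ k) 0)"

lemma first_order_one_param:
  assumes "finite I" "i \<in> I" "poly_matrix x" "x 0 = mat 1"
  shows "first_order I (\<lambda>z. x (z i * t)) (\<lambda>l. if l = i then mat t ** velocity x else 0)"
  unfolding first_order_def
proof (intro allI)
  fix j k
  obtain q where q: "\<And>a. x a $ j $ k = poly q a"
    using assms(3) unfolding poly_matrix_def by blast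
  obtain b q' where b: "q = pCons b q'" by (cases q)
  obtain b' q'' where b': "q' = pCons b' q''" by (cases q')
  have b0: "b = mat 1 $ j $ k"
    using q[of 0] assms(4) b by simp
  have "((\<lambda>a. poly q a) has_field_derivative poly (pderiv q) 0) (at 0)"
    by (rule poly_DERIV)
  then have "velocity x $ j $ k = poly (pderiv q) 0"
    using q by (simp add: velocity_def DERIV_imp_deriv)
  then have b1: "velocity x $ j $ k = b'"
    by (simp add: b b' pderiv_pCons)
  have "(\<lambda>z. t * t * ((z i * z i) * poly q'' (z i * t))) \<in> order_ge I 2"
    using order_ge_mult[OF order_ge_mult[OF order_ge_var order_ge_var] order_ge_poly, of I i i i q'' t] assms
    by (intro order_ge_cmult) (simp add: numeral_2_eq_2)
  moreover have "x (z i * t) $ j $ k - (mat 1 $ j $ k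
      + (\<Sum>l\<in>I. (if l = i then mat t ** velocity x else 0) $ j $ k * z l))
      = t * t * ((z i * z i) * poly q'' (z i * t))" for z
  proof -
    have "(mat t ** velocity x) $ j $ k = t * b'"
      by (simp add: matrix_matrix_mult_def mat_def if_distrib[of "\<lambda>x. x * _"] b1 cong: if_cong)
    then have "(\<Sum>l\<in>I. (if l = i then mat t ** velocity x else 0) $ j $ k * z l)
        = (\<Sum>l\<in>I. if l = i then t * b' * z l else 0)"
      by (intro sum.cong) auto
    then show ?thesis
      using assms by (simp add: q b b' b0 algebra_simps)
  qed
  ultimately show "(\<lambda>z. x (z i * t) $ j $ k - (mat 1 $ j $ k
      + (\<Sum>l\<in>I. (if l = i then mat t ** velocity x else 0) $ j $ k * z l))) \<in> order_ge I 2"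
    by simp
qed

text \<open>
  A one-parameter group satisfies \<open>x'(b) = x(b) x'(0)\<close>, so it would be constant if its velocity
  at 0 were zero.
\<close>

lemma velocity_nonzero:
  fixes x :: "complex \<Rightarrow> complex^'m::finite^'m"
  assumes "poly_matrix x" "\<And>a b. x (a + b) = x a ** x b" "inj x"
  shows "velocity x \<noteq> 0"
proof
  assume zero: "velocity x = 0"
  have der0: "((\<lambda>a. x a $ j $ k) has_field_derivative 0) (at 0)" for j k
  proof -
    obtain q where q: "\<And>a. x a $ j $ k = poly q a"
      using assms(1) unfolding poly_matrix_def by blast
    have "((\<lambda>a. x a $ j $ k) has_field_derivative poly (pderiv q) 0) (at 0)"
      unfolding q by (rule poly_DERIV)
    moreover from this have "poly (pderiv q) 0 = velocity x $ j $ k"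
      by (simp add: velocity_def DERIV_imp_deriv)
    ultimately show ?thesis using zero by simp
  qed
  have "((\<lambda>a. x a $ j $ k) has_field_derivative 0) (at b)" for b j k
  proof -
    have "((\<lambda>h. \<Sum>l\<in>UNIV. x b $ j $ l * x h $ l $ k) has_field_derivative (\<Sum>l\<in>UNIV. x b $ j $ l * 0)) (at 0)"
      by (intro DERIV_sum DERIV_cmult der0)
    then have "((\<lambda>h. x (b + h) $ j $ k) has_field_derivative 0) (at 0)"
      by (simp add: assms(2) matrix_matrix_mult_def)
    then show ?thesis by (simp add: DERIV_shift[of _ _ 0 b, simplified] add.commute)
  qed
  then have "x 0 $ j $ k = x 1 $ j $ k" for j k
    by (metis has_field_derivative_zero_constant UNIV_I convex_UNIV has_field_derivative_at_within)
  then have "x 0 = x 1" by (simp add: vec_eq_iff)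
  with \<open>inj x\<close> show False by (auto dest: injD)
qed

section \<open>Factorizations along a word\<close>

definition letter_sum :: "nat list \<Rightarrow> real list \<Rightarrow> nat \<Rightarrow> real" where
  "letter_sum v ts i = (\<Sum>(l, t)\<leftarrow>zip v ts. if l = i then t else 0)"

lemma sum_letter_sum:
  assumes "length v = length ts" "finite I" "set v \<subseteq> I"
  shows "(\<Sum>i\<in>I. letter_sum v ts i) = sum_list ts"
  using assms(1,3) by (induction v ts rule: list_induct2)
    (simp_all add: letter_sum_def sum.distrib assms(2))

lemma fword_Cons: "fword P (i # v) (t # ts) = xsub P i (of_real t) ** fword P v ts"
  by (simp add: fword_def)

locale pinned_group =
  fixes G :: "(complex^'m::finite^'m) set" and P :: "'m pinning"
  assumes pinning: "is_pinning G P"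
begin

abbreviation "T \<equiv> maxtorus P"
abbreviation "I \<equiv> {1..srank P}"

lemma subgroup_torus: "subgroup T GL"
  using pinning by (auto simp: is_pinning_def maximal_torus_def torus_def algebraic_group_def)

lemma matrix_inv_torus:
  assumes "\<tau> \<in> T"
  shows "matrix_inv \<tau> ** \<tau> = mat 1" and "\<tau> ** matrix_inv \<tau> = mat 1"
proof -
  have "invertible \<tau>"
    using subgroup.subset[OF subgroup_torus] assms by (auto simp: GL_def)
  then have "\<exists>B. \<tau> ** B = mat 1 \<and> B ** \<tau> = mat 1"
    by (simp add: invertible_def)
  then show "matrix_inv \<tau> ** \<tau> = mat 1" and "\<tau> ** matrix_inv \<tau> = mat 1"
    unfolding matrix_inv_def by (metis (mono_tags, lifting) someI_ex)+
qed

lemma torus_mult_closed: "\<sigma> \<in> T \<Longrightarrow> \<tau> \<in> T \<Longrightarrow> \<sigma> ** \<tau> \<in> T"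
  using subgroup.m_closed[OF subgroup_torus] by (auto simp: GL_def)

lemma torus_nonempty: "T \<noteq> {}"
  using subgroup.one_closed[OF subgroup_torus] by auto

lemma sroot_simple: "simple_roots G T (borel_pos P) (srank P) (sroot P)"
  using pinning by (simp add: is_pinning_def)

lemma sroot_character: "i \<in> I \<Longrightarrow> sroot P i \<in> characters T"
  using sroot_simple by (auto simp: simple_roots_def roots_def)

lemma xsub_param:
  "i \<in> I \<Longrightarrow> root_subgroup_param T (unipotent_radical (borel_pos P)) (sroot P i) (xsub P i)"
  using pinning by (simp add: is_pinning_def)

lemma xsub_add: "i \<in> I \<Longrightarrow> xsub P i (a + b) = xsub P i a ** xsub P i b"
  using xsub_param by (simp add: root_subgroup_param_def)

lemma xsub_conj:
  "i \<in> I \<Longrightarrow> \<tau> \<in> T \<Longrightarrow> \<tau> ** xsub P i a ** matrix_inv \<tau> = xsub P i (sroot P i \<tau> * a)"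
  using xsub_param by (simp add: root_subgroup_param_def)

lemma xsub_poly: "i \<in> I \<Longrightarrow> poly_matrix (xsub P i)"
  using xsub_param unfolding root_subgroup_param_def poly_matrix_def by meson

lemma xsub_inj: "i \<in> I \<Longrightarrow> inj (xsub P i)"
  using xsub_param unfolding root_subgroup_param_def by (metis injI)

text \<open>\<open>x\<^sub>i(0)\<close> is idempotent and invertible.\<close>

lemma xsub_0:
  assumes "i \<in> I"
  shows "xsub P i 0 = mat 1"
proof -
  have "subgroup (range (xsub P i)) GL"
    using xsub_param[OF assms] by (simp add: root_subgroup_param_def algebraic_group_def)
  then have "xsub P i 0 \<in> carrier GL"
    using subgroup.subset by blast
  then obtain B where "B ** xsub P i 0 = mat 1"
    by (auto simp: GL_def invertible_def)
  then show ?thesis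
    by (metis add_0 xsub_add[OF assms] matrix_mul_assoc matrix_mul_lid)
qed

text \<open>
  The product along \<open>v\<close> with every parameter of the letter \<open>i\<close> multiplied by a variable \<open>z\<^sub>i\<close>.
  Torus elements act on products by specializing \<open>z\<^sub>i\<close> to the simple roots.
\<close>

definition scaled :: "nat list \<Rightarrow> real list \<Rightarrow> (nat \<Rightarrow> complex) \<Rightarrow> complex^'m^'m" where
  "scaled v ts z = foldr (\<lambda>(i, t) A. xsub P i (z i * of_real t) ** A) (zip v ts) (mat 1)"

lemma torus_conj_fword:
  assumes "set v \<subseteq> I" "\<tau> \<in> T" "length v = length ts"
  shows "\<tau> ** fword P v ts ** matrix_inv \<tau> = scaled v ts (\<lambda>i. sroot P i \<tau>)"
  using assms(3,1)
proof (induction v ts rule: list_induct2)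
  case Nil
  then show ?case
    using matrix_inv_torus[OF assms(2)] by (simp add: fword_def scaled_def)
next
  case (Cons i v t ts)
  have "\<tau> ** (xsub P i (of_real t) ** fword P v ts) ** matrix_inv \<tau>
      = \<tau> ** xsub P i (of_real t) ** (matrix_inv \<tau> ** \<tau>) ** fword P v ts ** matrix_inv \<tau>"
    unfolding matrix_inv_torus(1)[OF assms(2)] by (simp add: matrix_mul_assoc)
  also have "\<dots> = (\<tau> ** xsub P i (of_real t) ** matrix_inv \<tau>) ** (\<tau> ** fword P v ts ** matrix_inv \<tau>)"
    by (simp add: matrix_mul_assoc)
  also have "\<dots> = xsub P i (sroot P i \<tau> * of_real t) ** scaled v ts (\<lambda>i. sroot P i \<tau>)"
    using Cons xsub_conj assms(2) by simp
  finally show ?case by (simp add: fword_Cons scaled_def)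
qed

lemma first_order_scaled:
  assumes "length v = length ts" "set v \<subseteq> I"
  shows "first_order I (scaled v ts) (\<lambda>i. mat (of_real (letter_sum v ts i)) ** velocity (xsub P i))"
  using assms
proof (induction v ts rule: list_induct2)
  case Nil
  have "mat 0 = (0 :: complex^'m^'m)" by (simp add: mat_def vec_eq_iff)
  then have "(mat 0 :: complex^'m^'m) ** A = 0" for A :: "complex^'m^'m"
    by (simp add: matrix_matrix_mult_def vec_eq_iff)
  then show ?case
    using first_order_one by (simp add: scaled_def[abs_def] letter_sum_def)
next
  case (Cons i v t ts)
  have add: "mat (of_real a + of_real b) ** A = mat (of_real a) ** A + mat (of_real b) ** A"
    for a b and A :: "complex^'m^'m"
    by (simp add: mat_def vec_eq_iff matrix_matrix_mult_def sum.distrib[symmetric] distrib_right[symmetric]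
        if_distrib[of "\<lambda>x. x * _"] cong: if_cong)
  have zero: "mat 0 ** A = 0" for A :: "complex^'m^'m"
    by (simp add: mat_def vec_eq_iff matrix_matrix_mult_def)
  have fo: "first_order I (\<lambda>z. xsub P i (z i * of_real t) ** scaled v ts z)
     (\<lambda>l. (if l = i then mat (of_real t) ** velocity (xsub P i) else 0)
          + mat (of_real (letter_sum v ts l)) ** velocity (xsub P l))"
    using Cons by (intro first_order_mult first_order_one_param xsub_poly xsub_0) auto
  have "(\<lambda>l. (if l = i then mat (of_real t) ** velocity (xsub P i) else 0)
          + mat (of_real (letter_sum v ts l)) ** velocity (xsub P l))
     = (\<lambda>l. mat (of_real (letter_sum (i # v) (t # ts) l)) ** velocity (xsub P l))"
    by (rule ext) (auto simp: letter_sum_def add)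
  moreover have "scaled (i # v) (t # ts) = (\<lambda>z. xsub P i (z i * of_real t) ** scaled v ts z)"
    by (simp add: scaled_def fun_eq_iff)
  ultimately show ?case using fo by simp
qed

text \<open>
  Two factorizations of one element have equal torus conjugates, so the difference of their scaled
  products vanishes at all values of the simple roots. Its linear coefficient at \<open>z\<^sub>i\<close> is the
  difference of the two letter sums times the nonzero matrix \<open>x\<^sub>i'(0)\<close>.
\<close>

lemma letter_sum_unique:
  assumes v: "length v = length ts" "set v \<subseteq> I"
    and u: "length u = length rs" "set u \<subseteq> I"
    and eq: "fword P v ts = fword P u rs" and "i \<in> I"
  shows "letter_sum v ts i = letter_sum u rs i"
proof -
  obtain j k where jk: "velocity (xsub P i) $ j $ k \<noteq> 0"
    using velocity_nonzero[OF xsub_poly xsub_add xsub_inj, OF \<open>i \<in> I\<close> \<open>i \<in> I\<close> \<open>i \<in> I\<close>]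
    by (auto simp: vec_eq_iff)
  define D where "D l = velocity (xsub P l) $ j $ k" for l
  define a where "a l = complex_of_real (letter_sum v ts l)" for l
  define b where "b l = complex_of_real (letter_sum u rs l)" for l
  have matD: "(mat c ** velocity (xsub P l)) $ j $ k = c * D l" for c l
    by (simp add: D_def matrix_matrix_mult_def mat_def if_distrib[of "\<lambda>x. x * _"] cong: if_cong)
  define Hv where "Hv z = scaled v ts z $ j $ k - (mat 1 $ j $ k + (\<Sum>l\<in>I. a l * D l * z l))" for z
  define Hu where "Hu z = scaled u rs z $ j $ k - (mat 1 $ j $ k + (\<Sum>l\<in>I. b l * D l * z l))" for z
  have "Hv \<in> order_ge I 2"
    using first_order_scaled[OF v, unfolded first_order_def matD, rule_format, of j k]
    unfolding Hv_def[abs_def] a_def matD .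
  moreover have "Hu \<in> order_ge I 2"
    using first_order_scaled[OF u, unfolded first_order_def matD, rule_format, of j k]
    unfolding Hu_def[abs_def] b_def matD .
  ultimately have H: "(\<lambda>z. Hv z + (-1) * Hu z) \<in> order_ge I 2"
    by (intro order_ge_add order_ge_cmult)
  have "a i * D i - b i * D i = 0"
  proof (rule linear_part_zero[where I = I and T = T and mul = "(**)" and \<alpha> = "sroot P" and j = i
        and d = "\<lambda>l. a l * D l - b l * D l", OF _ _ _ _ _ _ H])
    show "(\<Sum>l\<in>I. (a l * D l - b l * D l) * sroot P l \<tau>)
        + (Hv (\<lambda>l. sroot P l \<tau>) + - 1 * Hu (\<lambda>l. sroot P l \<tau>)) = 0" if "\<tau> \<in> T" for \<tau>
    proof -
      have "scaled v ts (\<lambda>l. sroot P l \<tau>) = scaled u rs (\<lambda>l. sroot P l \<tau>)"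
        using torus_conj_fword[OF v(2) that v(1)] torus_conj_fword[OF u(2) that u(1)] eq by simp
      then show ?thesis
        by (simp add: Hv_def Hu_def left_diff_distrib sum_subtractf)
    qed
    show "\<forall>i\<in>I. c i = 0" if "\<And>\<tau>. \<tau> \<in> T \<Longrightarrow> (\<Prod>i\<in>I. sroot P i \<tau> powi c i) = 1" for c
      using sroot_simple that unfolding simple_roots_def by blast
  qed (use sroot_character torus_mult_closed torus_nonempty \<open>i \<in> I\<close> in
      \<open>auto simp: characters_def\<close>)
  with jk show ?thesis by (simp add: D_def a_def b_def)
qed

corollary sum_list_unique:
  assumes "length v = length ts" "is_word P v" "length u = length rs" "is_word P u"
    and "fword P v ts = fword P u rs"
  shows "sum_list ts = sum_list rs"
proof -
  have "sum_list ts = (\<Sum>i\<in>I. letter_sum v ts i)"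
    using assms by (simp add: sum_letter_sum is_word_def)
  also have "\<dots> = (\<Sum>i\<in>I. letter_sum u rs i)"
    using assms by (intro sum.cong letter_sum_unique) (auto simp: is_word_def)
  also have "\<dots> = sum_list rs"
    using assms by (simp add: sum_letter_sum is_word_def)
  finally show ?thesis .
qed

end

section \<open>Nonnegative factorizations of a point of a cell\<close>

theorem lemma3p7:
  fixes G :: "(complex^'m::finite^'m) set"
    and P :: "'m pinning"
    and \<delta> :: "(complex^'m^'m) set \<Rightarrow> (complex^'m^'m) set \<Rightarrow> (complex^'m^'m) set"
    and w :: "(complex^'m^'m) set"
    and v :: "nat list"
    and p :: "complex^'m^'m"
  assumes "connected_reductive G"
    and "defined_over_reals G"
    and "split_over_reals G"
    and "is_pinning G P"
    and "finite (carrier (weyl G P))"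
    and "is_demazure_product G P \<delta>"
    and "w \<in> carrier (weyl G P) - {\<one>\<^bsub>weyl G P\<^esub>}"
    and "is_word P v"
    and "demazure_word G P \<delta> v = w"
    and "p \<in> Ucell G P w"
  shows "\<exists>K>0. fword P v -` {p} \<inter> nonneg_orthant (length v)
             = fword P v -` {p} \<inter> std_simplex (length v) K"
proof -
  interpret pinned_group G P by standard (rule assms(4))
  obtain R rs where R: "reduced_word G P w R" and rs: "rs \<in> pos_orthant (length R)"
    and p: "p = fword P R rs"
    using assms(10) by (auto simp: Ucell_def)
  have "word_prod G P R \<noteq> \<one>\<^bsub>weyl G P\<^esub>"
    using R assms(7) by (auto simp: reduced_word_def)
  then have "R \<noteq> []" by (auto simp: word_prod_def)
  then have "rs \<noteq> []" using rs by (auto simp: pos_orthant_def)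
  then have "sum_list rs > 0"
    using rs by (cases rs) (auto simp: pos_orthant_def intro!: add_pos_nonneg sum_list_nonneg)
  moreover have "sum_list ts = sum_list rs"
    if "fword P v ts = p" "ts \<in> nonneg_orthant (length v)" for ts
    using that R rs assms(8)
    by (intro sum_list_unique[of v ts R rs])
      (auto simp: p nonneg_orthant_def pos_orthant_def reduced_word_def)
  ultimately show ?thesis
    by (intro exI[of _ "sum_list rs"]) (auto simp: std_simplex_def)
qed

end
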